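(* Let $m,n$ be positive integers and let $f:\mathbb{R}^{m\times n}\to\mathbb{R}\cup\{+\infty\}$ be a lower semicontinuous function such that $f(X_k)/|X_k|^{\min(m,n)}\to+\infty$ for every sequence $(X_k)$ in $\mathbb{R}^{m\times n}$ with $|X_k|\to\infty$. Then for every $X\in\operatorname{dom} f$, $$f_{pc}(X)=\sup\Big\{v+\langle u,p(X)\rangle:\ (u,v)\in\mathbb{R}^N\times\mathbb{R},\ f(Z)-v-\langle u,p(Z)\rangle\ge0\ \ \forall Z\in\operatorname{dom} f\Big\}.$$
   Context: $|\cdot|$ is the Frobenius norm and $\operatorname{dom} f=\{X: f(X)<+\infty\}$ is the effective domain. Let $N=\sum_{s=1}^{\min(m,n)}\binom{m}{s}\binom{n}{s}$ and let $p:\mathbb{R}^{m\times n}\to\mathbb{R}^N$ map a matrix $X$ to the list (in some fixed order) of all its minors of orders $1,\dots,\min(m,n)$. A function $h:\mathbb{R}^{m\times n}\to\mathbb{R}\cup\{+\infty\}$ is polyconvex if there is a convex function $g:\mathbb{R}^N\to\mathbb{R}\cup\{+\infty\}$ with $h=g\circ p$. The polyconvex envelope $f_{pc}:\mathbb{R}^{m\times n}\to\mathbb{R}\cup\{\pm\infty\}$ of $f$ is $f_{pc}(X)=\sup_h h(X)$, the supremum being over all polyconvex $h:\mathbb{R}^{m\times n}\to\mathbb{R}\cup\{+\infty\}$ with $h\le f$ on $\mathbb{R}^{m\times n}$. *)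

theory Defs
  imports "Jordan_Normal_Form.Determinant" "HOL-Analysis.Analysis"
begin

(* Both notations are meant for the Analysis vectors below. *)
no_notation Matrix.vec_index (infixl "$" 100)
no_notation Matrix.scalar_prod (infix "\<bullet>" 70)

text \<open>
  A real \<open>m \<times> n\<close> matrix is an element of \<^typ>\<open>real^'n^'m\<close>, so that its \<^const>\<open>norm\<close> is the
  Frobenius norm. The linear orders on the index types are needed for the signs of the minors.

  The type of minor indices consists of the pairs of a nonempty set of rows and a set of columns
  of the same cardinality. It has \<open>N\<close> elements (lemma \<open>CARD_minor_index\<close>), so that
  \<open>real^('m, 'n) minor_index\<close> is the space \<open>\<real>\<^sup>N\<close>, its coordinates being named by the minors
  themselves instead of by their positions in a list.
\<close>

typedef ('m::finite, 'n::finite) minor_index =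
  "{(I :: 'm set, J :: 'n set). I \<noteq> {} \<and> card I = card J}"
proof
  show "({undefined}, {undefined}) \<in> {(I :: 'm set, J :: 'n set). I \<noteq> {} \<and> card I = card J}"
    by simp
qed

instance minor_index :: (finite, finite) finite
proof
  have "inj (Rep_minor_index :: ('a, 'b) minor_index \<Rightarrow> _)"
    by (simp add: inj_on_def Rep_minor_index_inject)
  then show "finite (UNIV :: ('a, 'b) minor_index set)"
    by (rule finite_imageD[rotated]) simp
qed

lemma CARD_minor_index:
  "CARD(('m::finite, 'n::finite) minor_index) =
     (\<Sum>s = 1..min CARD('m) CARD('n). (CARD('m) choose s) * (CARD('n) choose s))"
proof -
  let ?S = "{1..min CARD('m) CARD('n)}"
  let ?P = "\<lambda>s. {I :: 'm set. card I = s} \<times> {J :: 'n set. card J = s}"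
  interpret type_definition "Rep_minor_index :: ('m, 'n) minor_index \<Rightarrow> _" Abs_minor_index
    "{(I :: 'm set, J :: 'n set). I \<noteq> {} \<and> card I = card J}"
    by (rule type_definition_minor_index)
  have le: "card I \<le> CARD('m)" "card J \<le> CARD('n)" for I :: "'m set" and J :: "'n set"
    by (simp_all add: card_mono)
  have eq: "{(I :: 'm set, J :: 'n set). I \<noteq> {} \<and> card I = card J} = (\<Union>s\<in>?S. ?P s)"
  proof (intro Set.set_eqI iffI)
    fix x assume "x \<in> {(I :: 'm set, J :: 'n set). I \<noteq> {} \<and> card I = card J}"
    then obtain I J where x: "x = (I, J)" "I \<noteq> {}" "card I = card J"
      by auto
    have "card I > 0"
      using x(2) by (simp add: card_gt_0_iff)
    then show "x \<in> (\<Union>s\<in>?S. ?P s)"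
      using x le(1)[of I] le(2)[of J] by auto
  qed auto
  have "CARD(('m, 'n) minor_index) = card (\<Union>s\<in>?S. ?P s)"
    using card eq by simp
  also have "\<dots> = (\<Sum>s\<in>?S. card (?P s))"
    by (rule card_UN_disjoint) auto
  also have "\<dots> = (\<Sum>s\<in>?S. (CARD('m) choose s) * (CARD('n) choose s))"
    using n_subsets[of "UNIV :: 'm set"] n_subsets[of "UNIV :: 'n set"]
    by (simp add: card_cartesian_product)
  finally show ?thesis .
qed

definition minor :: "'m set \<Rightarrow> 'n set \<Rightarrow> real^'n::{finite,linorder}^'m::{finite,linorder} \<Rightarrow> real"
  where "minor I J X = Determinant.det (Matrix.mat (card I) (card J)
    (\<lambda>(i, j). X $ (sorted_list_of_set I ! i) $ (sorted_list_of_set J ! j)))"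

lemma minor_singleton: "minor {i} {j} X = X $ i $ j"
  by (simp add: minor_def det_single)

definition minors ::
    "real^'n::{finite,linorder}^'m::{finite,linorder} \<Rightarrow> real^('m::{finite,linorder}, 'n::{finite,linorder}) minor_index"
  where "minors X = (\<chi> k. case Rep_minor_index k of (I, J) \<Rightarrow> minor I J X)"

text \<open>
  Functions with values in \<open>\<real> \<union> {+\<infinity>}\<close> are functions into \<^typ>\<open>ereal\<close> that avoid \<open>-\<infinity>\<close>.
\<close>

definition avoids_minus_infinity :: "('a \<Rightarrow> ereal) \<Rightarrow> bool"
  where "avoids_minus_infinity f \<longleftrightarrow> (\<forall>x. f x \<noteq> -\<infinity>)"

definition effective_domain :: "('a \<Rightarrow> ereal) \<Rightarrow> 'a set"
  where "effective_domain f = {x. f x < \<infinity>}"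

definition lower_semicontinuous :: "('a::topological_space \<Rightarrow> ereal) \<Rightarrow> bool"
  where "lower_semicontinuous f \<longleftrightarrow> (\<forall>x. f x \<le> Liminf (at x) f)"

(* As for convex_on, which is restricted to real-valued functions. Here 0 * \<infinity> = 0 in ereal. *)
definition convex_ereal :: "('a::real_vector \<Rightarrow> ereal) \<Rightarrow> bool"
  where "convex_ereal g \<longleftrightarrow> (\<forall>x y. \<forall>u\<ge>0. \<forall>v\<ge>0. u + v = 1 \<longrightarrow>
    g (u *\<^sub>R x + v *\<^sub>R y) \<le> ereal u * g x + ereal v * g y)"

definition polyconvex ::
    "(real^'n::{finite,linorder}^'m::{finite,linorder} \<Rightarrow> ereal) \<Rightarrow> bool"
  where "polyconvex h \<longleftrightarrow>
    (\<exists>g :: real^('m::{finite,linorder}, 'n::{finite,linorder}) minor_index \<Rightarrow> ereal.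
      avoids_minus_infinity g \<and> convex_ereal g \<and> h = g \<circ> minors)"

definition polyconvex_envelope ::
    "(real^'n::{finite,linorder}^'m::{finite,linorder} \<Rightarrow> ereal)
      \<Rightarrow> real^'n::{finite,linorder}^'m::{finite,linorder} \<Rightarrow> ereal"
  where "polyconvex_envelope f X = (SUP h \<in> {h. polyconvex h \<and> (\<forall>Z. h Z \<le> f Z)}. h X)"

end

theory Submission
  imports Defs
begin

text \<open>
  Given a polyconvex \<open>h = g \<circ> p \<le> f\<close> and \<open>\<alpha> < h X\<close>, it suffices to find an affine minorant of \<open>f\<close> in
  terms of \<open>p\<close> whose value at \<open>X\<close> exceeds \<open>\<alpha>\<close>. As \<open>g\<close> need not be lower semicontinuous, and the
  epigraph of \<open>f\<close> over the minors is not compact, we apply the perspective map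
  \<open>(y, t) \<mapsto> (y, t, 1) / (1 + t)\<close> to it (after a shift to \<open>t \<ge> 0\<close>). Because \<open>f\<close> grows faster than the
  minors, the image becomes compact after adding the single point \<open>(0, 1, 0)\<close>, hence so is its convex
  hull. By convexity of \<open>g\<close>, this hull misses the image of \<open>(p X, \<alpha>)\<close>; the strictly separating
  hyperplane, evaluated at \<open>(0, 1, 0)\<close>, is not vertical and so yields the minorant.
\<close>

section \<open>Lower semicontinuous extended-real functions\<close>

lemma open_superlevel_set:
  assumes "lower_semicontinuous f"
  shows "open {x. c < f x}"
proof (subst open_subopen, safe)
  fix x assume "c < f x"
  then have "eventually (\<lambda>y. c < f y) (at x)"
    using assms unfolding lower_semicontinuous_def by (blast intro: less_LiminfD order.strict_trans2)
  with \<open>c < f x\<close> have "eventually (\<lambda>y. c < f y) (nhds x)"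
    by (auto simp: eventually_at_filter elim: eventually_mono)
  then show "\<exists>T. open T \<and> x \<in> T \<and> T \<subseteq> {x. c < f x}"
    unfolding eventually_nhds by blast
qed

lemma closed_epigraph:
  assumes "lower_semicontinuous f"
  shows "closed {(x, t). f x \<le> ereal t}"
proof -
  have "open (- {(x, t). f x \<le> ereal t})"
  proof (subst open_subopen, intro ballI)
    fix z assume "z \<in> - {(x, t). f x \<le> ereal t}"
    then obtain x t where z: "z = (x, t)" "ereal t < f x"
      by force
    \<comment> \<open>A real \<open>c\<close> strictly between \<open>t\<close> and
      \<open>f x\<close> splits the condition on the pair into two independent open conditions, one
      on each coordinate.\<close>
    then obtain c where c: "ereal t < ereal c" "ereal c < f x"
      using ereal_dense2 by blast
    have "open ({x. ereal c < f x} \<times> {..<c})"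
      using open_superlevel_set[OF assms] by (intro open_Times) auto
    moreover have "{x. ereal c < f x} \<times> {..<c} \<subseteq> - {(x, t). f x \<le> ereal t}"
      using order.strict_trans2 by fastforce
    ultimately show "\<exists>T. open T \<and> z \<in> T \<and> T \<subseteq> - {(x, t). f x \<le> ereal t}"
      using c z by (intro exI[of _ "{x. ereal c < f x} \<times> {..<c}"]) auto
  qed
  then show ?thesis
    by (simp add: closed_def)
qed

text \<open>The open superlevel sets at the levels \<open>- n\<close> cover \<open>K\<close> because
  \<open>f\<close> avoids minus infinity; the lowest level in a finite subcover is the
  bound.\<close>

lemma bounded_below_on_compact:
  assumes "lower_semicontinuous f" "avoids_minus_infinity f" "compact K"
  shows "\<exists>c. \<forall>x\<in>K. ereal c \<le> f x"
proof -
  have "K \<subseteq> (\<Union>n. {x. ereal (- real n) < f x})"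
  proof
    fix x
    have "f x > -\<infinity>"
      using assms(2) by (simp add: avoids_minus_infinity_def)
    then obtain r where "ereal r < f x"
      using ereal_dense2 by blast
    moreover obtain n where "- real n < r"
      using reals_Archimedean2[of "- r"] by (auto simp: minus_less_iff)
    ultimately show "x \<in> (\<Union>n. {x. ereal (- real n) < f x})"
      by (auto intro!: exI[of _ n] elim: less_trans[rotated])
  qed
  then obtain I where I: "finite I" "K \<subseteq> (\<Union>n\<in>I. {x. ereal (- real n) < f x})"
    by (rule compactE_image[OF assms(3), rotated]) (auto intro: open_superlevel_set[OF assms(1)])
  have "ereal (- real (Max I)) \<le> f x" if x: "x \<in> K" for x
  proof -
    obtain n where n: "n \<in> I" "ereal (- real n) < f x"
      using I(2) x by auto
    then have "ereal (- real (Max I)) \<le> ereal (- real n)"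
      using I(1) by simp
    with n(2) show ?thesis
      by (meson less_imp_le order_trans)
  qed
  then show ?thesis by blast
qed

section \<open>Convex epigraphs and perspective cones\<close>

lemma convex_epigraph:
  assumes "convex_ereal g"
  shows "convex {(x, t). g x \<le> ereal t}"
proof (rule convexI)
  fix a b and u v :: real
  assume "a \<in> {(x, t). g x \<le> ereal t}" "b \<in> {(x, t). g x \<le> ereal t}"
    and uv: "0 \<le> u" "0 \<le> v" "u + v = 1"
  then obtain x s y t where *: "a = (x, s)" "g x \<le> ereal s" "b = (y, t)" "g y \<le> ereal t"
    by blast
  have "g (u *\<^sub>R x + v *\<^sub>R y) \<le> ereal u * g x + ereal v * g y"
    using assms uv unfolding convex_ereal_def by blast
  also have "\<dots> \<le> ereal u * ereal s + ereal v * ereal t"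
    using * uv by (intro add_mono ereal_mult_left_mono) auto
  finally show "u *\<^sub>R a + v *\<^sub>R b \<in> {(x, t). g x \<le> ereal t}"
    by (simp add: *)
qed

text \<open>Normalising \<open>u *\<^sub>R x + v *\<^sub>R y\<close> by its last coordinate
  \<open>B\<close> gives a convex combination of the two normalised points, with the new weights
  \<open>u * b / B\<close> and \<open>v * b' / B\<close>.\<close>

lemma convex_perspective:
  fixes E :: "'a::real_vector set"
  assumes "convex E"
  shows "convex {(e, b :: real). 0 < b \<and> (1 / b) *\<^sub>R e \<in> E}"
proof (rule convexI)
  let ?D = "{(e, b :: real). 0 < b \<and> (1 / b) *\<^sub>R e \<in> E}"
  fix x y and u v :: real
  assume "x \<in> ?D" "y \<in> ?D" and uv: "0 \<le> u" "0 \<le> v" "u + v = 1"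
  then obtain e b e' b' where xy: "x = (e, b)" "y = (e', b')"
    and *: "0 < b" "(1 / b) *\<^sub>R e \<in> E" "0 < b'" "(1 / b') *\<^sub>R e' \<in> E"
    by blast
  define B where "B = u * b + v * b'"
  have B: "0 < B"
    using * uv unfolding B_def by (cases "u = 0") (auto intro: add_pos_nonneg)
  have "u * b / B + v * b' / B = B / B"
    by (simp only: B_def add_divide_distrib)
  then have "u * b / B + v * b' / B = 1"
    using B by simp
  then have "(u * b / B) *\<^sub>R ((1 / b) *\<^sub>R e) + (v * b' / B) *\<^sub>R ((1 / b') *\<^sub>R e') \<in> E"
    using * uv B by (intro convexD[OF assms]) auto
  then have "(1 / B) *\<^sub>R (u *\<^sub>R e + v *\<^sub>R e') \<in> E"
    using * by (simp add: scaleR_add_right)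
  with B show "u *\<^sub>R x + v *\<^sub>R y \<in> ?D"
    by (simp add: xy B_def)
qed

section \<open>Compactness of the perspective image of an epigraph\<close>

text \<open>The member of an open cover that contains \<open>a\<close> swallows a ball around
  \<open>a\<close>, so only the compact set \<open>K\<close> is left to be covered.\<close>

lemma compact_insert_limit_point:
  fixes a :: "'a::metric_space"
  assumes "\<And>e. 0 < e \<Longrightarrow> \<exists>K. compact K \<and> K \<subseteq> insert a W \<and> W \<subseteq> K \<union> ball a e"
  shows "compact (insert a W)"
proof (rule compactI)
  fix C assume C: "\<forall>t\<in>C. open t" "insert a W \<subseteq> \<Union>C"
  then obtain U where U: "U \<in> C" "a \<in> U"
    by auto
  then obtain e where e: "0 < e" "ball a e \<subseteq> U"
    using C(1) openE by blast
  obtain K where K: "compact K" "K \<subseteq> insert a W" "W \<subseteq> K \<union> ball a e"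
    using assms[OF e(1)] by metis
  obtain D where D: "D \<subseteq> C" "finite D" "K \<subseteq> \<Union>D"
    using compactE[OF K(1) order_trans[OF K(2) C(2)]] C(1) by metis
  show "\<exists>C'\<subseteq>C. finite C' \<and> insert a W \<subseteq> \<Union>C'"
    using D U e K by (intro exI[of _ "insert U D"]) auto
qed

text \<open>The part of the epigraph up to a height \<open>R\<close> is closed and bounded, so its
  image is compact. Above \<open>R\<close> the growth bound makes \<open>p Z\<close> small relative
  to \<open>t\<close>, and the image falls into a small ball around
  \<open>((0, 1), 0)\<close>.\<close>

lemma compact_perspective_epigraph:
  fixes p :: "'a::euclidean_space \<Rightarrow> 'b::euclidean_space" and f :: "'a \<Rightarrow> ereal"
  assumes p: "continuous_on UNIV p"
    and lsc: "lower_semicontinuous f"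
    and c: "\<And>Z. ereal c \<le> f Z"
    and bdd: "\<And>t. bounded {Z. f Z \<le> ereal t}"
    and growth: "\<And>e. 0 < e \<Longrightarrow> \<exists>B. \<forall>Z t. f Z \<le> ereal t \<longrightarrow> norm (p Z) \<le> e * t + B"
  shows "compact (insert ((0, 1), 0)
    ((\<lambda>(Z, t). (1 / (1 + (t - c))) *\<^sub>R ((p Z, t - c), 1 :: real)) ` {(Z, t). f Z \<le> ereal t}))"
proof (rule compact_insert_limit_point)
  let ?w = "\<lambda>(Z, t). (1 / (1 + (t - c))) *\<^sub>R ((p Z, t - c), 1 :: real)"
  fix e :: real assume e: "0 < e"
  obtain B where B: "\<And>Z t. f Z \<le> ereal t \<Longrightarrow> norm (p Z) \<le> e / 4 * t + B"
    using growth[of "e / 4"] e by auto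
  \<comment> \<open>For \<open>t > R\<close>, the scale \<open>s = 1 + (t - c)\<close> satisfies
    \<open>e * s / 4 >= |B + e * c / 4| + 2\<close>, hence
    \<open>norm (p Z) + 2 <= e * s / 2\<close>. The 2 pays for the coordinates -1 and 1 in the
    difference from the limit point, which is computed below.\<close>
  define R where "R = (4 * \<bar>B + e / 4 * c\<bar> + 8) / e + \<bar>c\<bar>"
  have ge: "c \<le> t" if "f Z \<le> ereal t" for Z t
    using c[of Z] that by (metis ereal_less_eq(3) order_trans)
  let ?S = "{(Z, t). f Z \<le> ereal t} \<inter> (UNIV \<times> {..R})"
  have "?S \<subseteq> {Z. f Z \<le> ereal R} \<times> {c..R}"
    using ge by (auto intro: order_trans)
  then have "bounded ?S"
    using bounded_Times[OF bdd bounded_closed_interval] by (rule bounded_subset[rotated])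
  moreover have "closed ?S"
    by (intro closed_Int closed_epigraph lsc closed_Times) auto
  ultimately have "compact ?S"
    by (simp add: compact_eq_bounded_closed)
  moreover have "continuous_on ?S ?w"
    unfolding case_prod_unfold
    using ge by (intro continuous_intros continuous_on_compose2[OF p]) fastforce+
  ultimately have "compact (?w ` ?S)"
    by (rule compact_continuous_image[rotated])
  moreover have "?w (Z, t) \<in> ball ((0, 1), 0) e" if Zt: "f Z \<le> ereal t" "R < t" for Z t
  proof -
    define s where "s = 1 + (t - c)"
    have s: "1 \<le> s" "(4 * \<bar>B + e / 4 * c\<bar> + 8) / e \<le> s"
      using ge[OF Zt(1)] Zt(2) by (auto simp: s_def R_def)
    have s': "4 * \<bar>B + e / 4 * c\<bar> + 8 \<le> s * e"
      using s(2) e by (simp add: field_simps)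
    have "norm (p Z) \<le> e / 4 * (s + c - 1) + B"
      using B[OF Zt(1)] by (simp add: s_def)
    also have "\<dots> \<le> e / 4 * s + (B + e / 4 * c)"
      using e by (simp add: field_simps)
    also have "\<dots> \<le> e / 2 * s - 2"
      using s' by (simp add: abs_if field_simps split: if_splits)
    finally have 1: "norm (p Z) + 2 \<le> e / 2 * s" by simp
    have eq: "?w (Z, t) - ((0, 1), 0) = (1 / s) *\<^sub>R ((p Z, -1), 1)"
      using s(1) by (simp add: s_def field_simps)
    then have "norm (?w (Z, t) - ((0, 1), 0)) = norm ((p Z, -1 :: real), 1 :: real) / s"
      using s(1) unfolding eq norm_scaleR by simp
    also have "\<dots> \<le> (norm (p Z) + 2) / s"
      using s(1) norm_Pair_le[of "(p Z, -1 :: real)" "1 :: real"] norm_Pair_le[of "p Z" "-1 :: real"]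
      by (intro divide_right_mono) auto
    also have "\<dots> < e"
      using 1 s(1) e by (simp add: field_simps) (smt (verit) mult_pos_pos)
    finally show ?thesis
      by (simp only: mem_ball dist_norm norm_minus_commute)
  qed
  ultimately show "\<exists>K. compact K \<and> K \<subseteq> insert ((0, 1), 0) (?w ` {(Z, t). f Z \<le> ereal t})
      \<and> ?w ` {(Z, t). f Z \<le> ereal t} \<subseteq> K \<union> ball ((0, 1), 0) e"
    by (intro exI[of _ "?w ` ?S"]) (force simp: not_le)
qed

section \<open>Separation in perspective coordinates\<close>

text \<open>Determinants are abstracted away: the minors enter the argument only through continuity
  and through being dominated by \<open>f\<close>.\<close>

lemma exists_affine_minorant:
  fixes p :: "'a::euclidean_space \<Rightarrow> 'b::euclidean_space" and f :: "'a \<Rightarrow> ereal"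
  assumes p: "continuous_on UNIV p"
    and lsc: "lower_semicontinuous f"
    and lower: "\<And>Z. ereal c \<le> f Z"
    and bdd: "\<And>t. bounded {Z. f Z \<le> ereal t}"
    and growth: "\<And>e. 0 < e \<Longrightarrow> \<exists>B. \<forall>Z t. f Z \<le> ereal t \<longrightarrow> norm (p Z) \<le> e * t + B"
    and g: "convex_ereal g" "\<And>Z. g (p Z) \<le> f Z"
    and \<alpha>: "ereal \<alpha> < g y"
  obtains u v where "\<And>Z. ereal (v + u \<bullet> p Z) \<le> f Z" "\<alpha> < v + u \<bullet> y"
proof -
  \<comment> \<open>Taking the minimum with \<open>\<alpha>\<close> keeps the denominator
    \<open>1 + (t - d)\<close> positive at the point \<open>(y, \<alpha>)\<close> too.\<close>
  define d where "d = min c \<alpha>"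
  have d: "ereal d \<le> f Z" for Z
    using lower[of Z] by (metis d_def ereal_less_eq(3) min.cobounded1 order_trans)
  have ge: "d \<le> t" if "f Z \<le> ereal t" for Z t
    using d[of Z] that by (metis ereal_less_eq(3) order_trans)
  define w where "w = (\<lambda>z t. (1 / (1 + (t - d))) *\<^sub>R ((z :: 'b, t - d), 1 :: real))"
  define W where "W = (\<lambda>(Z, t). w (p Z) t) ` {(Z, t). f Z \<le> ereal t}"
  \<comment> \<open>The perspective cone over the epigraph of \<open>g\<close>, lowered by
    \<open>d\<close>. It confines the hull of \<open>W\<close> to points with positive last
    coordinate whose normalisation lies in that epigraph.\<close>
  define D where "D = {(e, b :: real). 0 < b \<and> (1 / b) *\<^sub>R e \<in> {(z, t). g z \<le> ereal (t + d)}}"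
  have "convex {(z, t). g z \<le> ereal (t + d)}"
  proof -
    have "{(z, t). g z \<le> ereal (t + d)} = (\<lambda>x. (0, - d) + x) ` {(z, t). g z \<le> ereal t}"
      by (force simp: image_iff)
    then show ?thesis
      using convex_translation[OF convex_epigraph[OF g(1)], of "(0, - d)"] by simp
  qed
  then have D: "convex D"
    unfolding D_def by (rule convex_perspective)
  have "W \<subseteq> D"
  proof
    fix x assume "x \<in> W"
    then obtain Z t where x: "x = w (p Z) t" "f Z \<le> ereal t"
      by (auto simp: W_def)
    then show "x \<in> D"
      using ge[OF x(2)] g(2)[of Z] by (auto simp: D_def w_def)
  qed
  then have hull: "convex hull W \<subseteq> D"
    using D by (rule hull_minimal)
  have "w y \<alpha> \<notin> convex hull (insert ((0, 1), 0) W)"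
  proof
    have \<alpha>d: "0 < 1 + (\<alpha> - d)"
      by (simp add: d_def min_def)
    assume *: "w y \<alpha> \<in> convex hull (insert ((0, 1), 0) W)"
    show False
    \<comment> \<open>If \<open>f\<close> is infinite everywhere, the hull is just the limit point,
      whose last coordinate is 0, unlike that of \<open>w y \<alpha>\<close>.\<close>
    proof (cases "W = {}")
      case True
      with * \<alpha>d show False by (simp add: w_def)
    next
      case False
      then obtain u v b where uv: "0 \<le> u" "0 \<le> v" "b \<in> convex hull W"
          "w y \<alpha> = u *\<^sub>R ((0, 1), 0) + v *\<^sub>R b"
        using * unfolding convex_hull_insert[OF False] by blast
      obtain z a r where b: "b = ((z, a), r)"
        by (metis surj_pair)
      have r: "0 < r" "g ((1 / r) *\<^sub>R z) \<le> ereal (a / r + d)"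
        using uv(3) hull b by (auto simp: D_def)
      define q where "q = 1 / (1 + (\<alpha> - d))"
      have "w y \<alpha> = ((q *\<^sub>R y, q * (\<alpha> - d)), q)"
        by (simp add: w_def q_def)
      \<comment> \<open>The limit point contributes only to the vertical coordinate, and upwards.
        Thus \<open>y\<close> equals \<open>(1 / r) *\<^sub>R z\<close>, and \<open>\<alpha>\<close>
        is at least \<open>a / r + d\<close>, the height at which \<open>b\<close> bounds
        \<open>g y\<close>: a contradiction.\<close>
      then have q: "q = v * r" "q *\<^sub>R y = v *\<^sub>R z" "q * (\<alpha> - d) = u + v * a" "0 < q"
        using uv(4) \<alpha>d by (simp_all add: b q_def)
      have v: "0 < v"
        using q r(1) uv(2) by (metis less_eq_real_def mult_zero_left less_irrefl)
      have "y = (1 / q) *\<^sub>R (q *\<^sub>R y)"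
        using q(4) by simp
      also have "\<dots> = (1 / r) *\<^sub>R z"
        unfolding q(2) using v by (simp add: q(1))
      finally have "g y \<le> ereal (a / r + d)"
        using r by simp
      also have "a / r + d \<le> \<alpha>"
      proof -
        have "v * a \<le> v * (r * (\<alpha> - d))"
          using q(1,3) uv(1) by (simp add: mult.assoc)
        then have "a \<le> r * (\<alpha> - d)"
          using v by simp
        then show ?thesis
          using r(1) by (simp add: field_simps)
      qed
      finally show False
        using \<alpha> by simp
    qed
  qed
  moreover have "compact (convex hull (insert ((0, 1), 0) W))"
    unfolding W_def w_def
    using compact_perspective_epigraph[OF p lsc d bdd growth]
    by (intro compact_convex_hull) simp
  ultimately obtain n k where nk: "n \<bullet> w y \<alpha> < k"
      "\<And>x. x \<in> convex hull (insert ((0, 1), 0) W) \<Longrightarrow> k < n \<bullet> x"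
    using separating_hyperplane_closed_point[OF convex_convex_hull compact_imp_closed] by metis
  obtain u s r where n: "n = ((u, s), r)"
    by (metis surj_pair)
  have s: "k < s"
    using nk(2)[of "((0, 1), 0)"] by (simp add: hull_inc n)
  \<comment> \<open>Writing \<open>k\<close> over the common denominator turns the separation into
    the sign of an expression affine in \<open>z\<close> and \<open>t\<close>, where
    \<open>t\<close> has the positive coefficient \<open>s - k\<close>.\<close>
  have w: "n \<bullet> w z t - k = (u \<bullet> z + (s - k) * (t - d) + (r - k)) / (1 + (t - d))" if "d \<le> t" for z t
  proof -
    have "n \<bullet> w z t = (u \<bullet> z + s * (t - d) + r) / (1 + (t - d))"
      by (simp add: n w_def add_divide_distrib)
    moreover have "k = k * (1 + (t - d)) / (1 + (t - d))"
      using that by simp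
    ultimately have "n \<bullet> w z t - k =
        ((u \<bullet> z + s * (t - d) + r) - k * (1 + (t - d))) / (1 + (t - d))"
      by (simp add: diff_divide_distrib)
    then show ?thesis
      by (simp add: algebra_simps)
  qed
  have *: "0 < u \<bullet> p Z + (s - k) * (t - d) + (r - k)" if "f Z \<le> ereal t" for Z t
  proof -
    have "w (p Z) t \<in> convex hull (insert ((0, 1), 0) W)"
      using that by (intro hull_inc) (auto simp: W_def)
    then have "0 < n \<bullet> w (p Z) t - k"
      using nk(2) by simp
    then show ?thesis
      using ge[OF that] by (simp add: w zero_less_divide_iff)
  qed
  have **: "u \<bullet> y + (s - k) * (\<alpha> - d) + (r - k) < 0"
  proof -
    have "d \<le> \<alpha>" by (simp add: d_def)
    then show ?thesis
      using nk(1) w[of \<alpha> y] by (smt (verit) divide_nonneg_pos)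
  qed
  show thesis
  proof (rule that)
    \<comment> \<open>Solving the affine inequality for \<open>t\<close> gives these coefficients.
      Points of the epigraph of \<open>f\<close> lie above the resulting hyperplane, and
      \<open>(y, \<alpha>)\<close> lies strictly below it.\<close>
    let ?u = "(- 1 / (s - k)) *\<^sub>R u" and ?v = "d - (r - k) / (s - k)"
    have affine: "?v + ?u \<bullet> z = d - (u \<bullet> z + (r - k)) / (s - k)" for z
      by (simp add: add_divide_distrib)
    show "ereal (?v + ?u \<bullet> p Z) \<le> f Z" for Z
    proof (cases "f Z")
      case (real t)
      then have "d - t \<le> (u \<bullet> p Z + (r - k)) / (s - k)"
        using *[of Z t] s
        by (subst pos_le_divide_eq) (simp_all add: algebra_simps)
      then show ?thesis
        unfolding affine real by simp
    qed (use d[of Z] in auto)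
    have "(u \<bullet> y + (r - k)) / (s - k) < d - \<alpha>"
      using ** s by (subst pos_divide_less_eq) (simp_all add: algebra_simps)
    then show "\<alpha> < ?v + ?u \<bullet> y"
      unfolding affine by simp
  qed
qed

section \<open>Continuity and growth of the minors\<close>

text \<open>The Leibniz formula exhibits a minor as a polynomial in the entries, from which both
  continuity and the norm bound are read off.\<close>

lemma minor_eq_sum:
  assumes "card I = card J"
  shows "minor I J X = (\<Sum>p | p permutes {0..<card I}. signof p *
    (\<Prod>i = 0..<card I. X $ (sorted_list_of_set I ! i) $ (sorted_list_of_set J ! p i)))"
proof -
  have "p i < card I" if "p permutes {0..<card I}" "i < card I" for p i
    using permutes_in_image[OF that(1), of i] that(2) by simp
  then show ?thesis
    unfolding minor_def Determinant.det_def
    by (simp only: dim_row_mat dim_col_mat assms simp_thms if_True)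
      (intro sum.cong refl arg_cong2[where f = "(*)"] prod.cong, auto simp: assms)
qed

lemma minors_nth:
  obtains I J where "card I = card J" "card I \<le> min CARD('m) CARD('n)"
    "\<And>X :: real^'n::{finite,linorder}^'m::{finite,linorder}. minors X $ k = minor I J X"
proof -
  obtain I J where IJ: "Rep_minor_index k = (I, J)"
    by force
  then have "card I = card J"
    using Rep_minor_index[of k] by auto
  moreover have "card I \<le> CARD('m)" "card J \<le> CARD('n)"
    by (simp_all add: card_mono)
  ultimately show thesis
    by (intro that[of I J]) (auto simp: minors_def IJ)
qed

lemma continuous_on_minors: "continuous_on S (minors :: real^'n::{finite,linorder}^'m::{finite,linorder} \<Rightarrow> _)"
proof -
  have "continuous_on S (\<lambda>X :: real^'n::{finite,linorder}^'m::{finite,linorder}. minors X $ k)" for k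
  proof -
    obtain I J where "card I = card J" "\<And>X. minors X $ k = minor I J X"
      using minors_nth[of k] by metis
    then show ?thesis
      by (simp add: minor_eq_sum) (intro continuous_intros)
  qed
  from continuous_on_vec_lambda[of S "\<lambda>k X. minors X $ k", OF this] show ?thesis
    by simp
qed

text \<open>A minor is a signed sum of products of at most \<open>min CARD('m) CARD('n)\<close>
  entries, each bounded by the Frobenius norm. When this norm is at least 1, the lower powers are
  absorbed by the highest.\<close>

lemma norm_minors_le:
  obtains C where "0 \<le> C" "\<And>X :: real^'n::{finite,linorder}^'m::{finite,linorder}. 1 \<le> norm X \<Longrightarrow>
    norm (minors X) \<le> C * norm X ^ min CARD('m) CARD('n)"
proof -
  have "\<exists>C\<ge>0. \<forall>X :: real^'n::{finite,linorder}^'m::{finite,linorder}. 1 \<le> norm X \<longrightarrow>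
    \<bar>minors X $ k\<bar> \<le> C * norm X ^ min CARD('m) CARD('n)" for k
  proof -
    obtain I :: "'m set" and J :: "'n set" where IJ: "card I = card J" "card I \<le> min CARD('m) CARD('n)"
      "\<And>X :: real^'n::{finite,linorder}^'m::{finite,linorder}. minors X $ k = minor I J X"
      using minors_nth[of k] by metis
    let ?P = "{p. p permutes {0..<card I}}"
    have "\<bar>minors X $ k\<bar> \<le> real (card ?P) * norm X ^ min CARD('m) CARD('n)"
      if X: "1 \<le> norm X" for X :: "real^'n::{finite,linorder}^'m::{finite,linorder}"
    proof -
      have entry: "\<bar>X $ i $ j\<bar> \<le> norm X" for i j
        using Finite_Cartesian_Product.norm_nth_le[of "X $ i" j] Finite_Cartesian_Product.norm_nth_le[of X i]
        by simp
      have "\<bar>minors X $ k\<bar> \<le> (\<Sum>p\<in>?P. norm X ^ min CARD('m) CARD('n))"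
        unfolding IJ(3) minor_eq_sum[OF IJ(1)]
      proof (rule order_trans[OF sum_abs], rule sum_mono)
        fix p
        let ?x = "\<lambda>i. X $ (sorted_list_of_set I ! i) $ (sorted_list_of_set J ! p i)"
        have "\<bar>signof p * prod ?x {0..<card I}\<bar> = (\<Prod>i = 0..<card I. \<bar>?x i\<bar>)"
          by (simp add: abs_mult abs_prod sign_def)
        also have "\<dots> \<le> (\<Prod>i = 0..<card I. norm X)"
          using entry by (intro prod_mono) auto
        also have "\<dots> \<le> norm X ^ min CARD('m) CARD('n)"
          using X IJ(2) by (simp add: power_increasing)
        finally show "\<bar>signof p * prod ?x {0..<card I}\<bar> \<le> norm X ^ min CARD('m) CARD('n)" .
      qed
      then show ?thesis by simp
    qed
    then show ?thesis
      by (intro exI[of _ "real (card ?P)"]) auto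
  qed
  then obtain C where C: "\<And>k. 0 \<le> C k" "\<And>k (X :: real^'n::{finite,linorder}^'m::{finite,linorder}).
      1 \<le> norm X \<Longrightarrow> \<bar>minors X $ k\<bar> \<le> C k * norm X ^ min CARD('m) CARD('n)"
    by metis
  show thesis
  proof (rule that)
    show "0 \<le> sum C UNIV"
      using C(1) by (simp add: sum_nonneg)
    fix X :: "real^'n::{finite,linorder}^'m::{finite,linorder}" assume "1 \<le> norm X"
    then show "norm (minors X) \<le> sum C UNIV * norm X ^ min CARD('m) CARD('n)"
      unfolding sum_distrib_right
      by (intro order_trans[OF norm_le_l1_cart] sum_mono C(2))
  qed
qed

section \<open>The growth condition and the envelope formula\<close>

text \<open>If the bound failed for every radius \<open>k + 1\<close>, the counterexamples would
  form a sequence with norms tending to infinity along which the quotient stays below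
  \<open>M\<close>.\<close>

lemma superlinear_growth:
  fixes f :: "'a::real_normed_vector \<Rightarrow> ereal"
  assumes "\<And>X :: nat \<Rightarrow> 'a. filterlim (\<lambda>k. norm (X k)) at_top sequentially \<Longrightarrow>
             (\<lambda>k. f (X k) / ereal (norm (X k) ^ d)) \<longlonglongrightarrow> \<infinity>"
  shows "\<exists>R\<ge>1. \<forall>Z. R < norm Z \<longrightarrow> ereal (M * norm Z ^ d) \<le> f Z"
proof (rule ccontr)
  assume "\<not> ?thesis"
  then have "\<exists>Z. real k + 1 < norm Z \<and> f Z < ereal (M * norm Z ^ d)" for k
    by (metis le_add_same_cancel2 not_le of_nat_0_le_iff)
  then obtain X where X: "\<And>k. real k + 1 < norm (X k)" "\<And>k. f (X k) < ereal (M * norm (X k) ^ d)"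
    by metis
  have "filterlim (\<lambda>k. norm (X k)) at_top sequentially"
    by (rule filterlim_at_top_mono[OF filterlim_real_sequentially])
      (auto intro!: always_eventually order.strict_implies_order order.strict_trans[OF _ X(1)])
  from order_tendstoD(1)[OF assms[OF this], of "ereal M"]
  obtain k where k: "ereal M < f (X k) / ereal (norm (X k) ^ d)"
    by (auto simp: eventually_sequentially)
  have X0: "0 < norm (X k)"
    using X(1)[of k] by linarith
  then have "0 < norm (X k) ^ d"
    by (rule zero_less_power)
  then have "ereal (M * norm (X k) ^ d) \<le> f (X k)"
    using k X0 by (cases "f (X k)") (auto simp: field_simps)
  with X(2)[of k] show False by simp
qed

theorem theorem3p2:
  fixes f :: "real^'n::{finite,linorder}^'m::{finite,linorder} \<Rightarrow> ereal"
  assumes "avoids_minus_infinity f"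
    and "lower_semicontinuous f"
    and "\<And>X :: nat \<Rightarrow> real^'n::{finite,linorder}^'m::{finite,linorder}. filterlim (\<lambda>k. norm (X k)) at_top sequentially \<Longrightarrow>
           (\<lambda>k. f (X k) / ereal (norm (X k) ^ min CARD('m) CARD('n))) \<longlonglongrightarrow> \<infinity>"
  shows "\<forall>X \<in> effective_domain f.
    polyconvex_envelope f X =
      Sup {ereal (v + u \<bullet> minors X) | (u :: real^('m::{finite,linorder}, 'n::{finite,linorder}) minor_index) (v :: real).
        \<forall>Z \<in> effective_domain f. f Z - ereal v - ereal (u \<bullet> minors Z) \<ge> 0}"
proof (intro ballI antisym)
  let ?d = "min CARD('m) CARD('n)"
  let ?admissible = "\<lambda>(u :: real^('m::{finite,linorder}, 'n::{finite,linorder}) minor_index) v.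
    \<forall>Z \<in> effective_domain f. f Z - ereal v - ereal (u \<bullet> minors Z) \<ge> 0"
  \<comment> \<open>Outside the effective domain \<open>f\<close> is infinite, so the constraint may
    be imposed at every \<open>Z\<close>.\<close>
  have admissible: "?admissible u v \<longleftrightarrow> (\<forall>Z. ereal (v + u \<bullet> minors Z) \<le> f Z)" for u v
  proof -
    have "(Z \<in> effective_domain f \<longrightarrow> f Z - ereal v - ereal (u \<bullet> minors Z) \<ge> 0) \<longleftrightarrow>
        ereal (v + u \<bullet> minors Z) \<le> f Z" for Z
      using assms(1)
      by (cases "f Z") (auto simp: effective_domain_def avoids_minus_infinity_def)
    then show ?thesis by blast
  qed
  note growth = superlinear_growth[where f = f, OF assms(3)]
  fix X
  let ?A = "{ereal (v + u \<bullet> minors X) | u v. ?admissible u v}"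
  show "Sup ?A \<le> polyconvex_envelope f X"
  proof (rule Sup_least, clarify)
    fix u v assume *: "?admissible u v"
    let ?g = "\<lambda>y. ereal (v + u \<bullet> y)"
    have "convex_ereal ?g"
      unfolding convex_ereal_def
    proof (intro allI impI)
      fix x y and s t :: real assume "0 \<le> s" "0 \<le> t" "s + t = 1"
      then have "v = s * v + t * v"
        by (metis distrib_right mult_1)
      then show "?g (s *\<^sub>R x + t *\<^sub>R y) \<le> ereal s * ?g x + ereal t * ?g y"
        by (simp add: algebra_simps)
    qed
    then have "polyconvex (?g \<circ> minors)"
      unfolding polyconvex_def avoids_minus_infinity_def by (intro exI[of _ ?g]) simp
    then show "ereal (v + u \<bullet> minors X) \<le> polyconvex_envelope f X"
      unfolding polyconvex_envelope_def
      using * by (intro SUP_upper2[of "?g \<circ> minors"]) (auto simp: admissible)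
  qed
  show "polyconvex_envelope f X \<le> Sup ?A"
    unfolding polyconvex_envelope_def
  proof (rule SUP_least, clarify)
    fix h assume h: "polyconvex h" "\<forall>Z. h Z \<le> f Z"
    then obtain g where g: "convex_ereal g" "h = g \<circ> minors"
      by (auto simp: polyconvex_def)
    \<comment> \<open>Outside this ball \<open>f\<close> is nonnegative by growth; inside it
      semicontinuity gives a bound \<open>c\<close>. Together they yield the global bound
      \<open>min c 0\<close>.\<close>
    obtain R where R: "1 \<le> R" "\<And>Z. R < norm Z \<Longrightarrow> ereal (1 * norm Z ^ ?d) \<le> f Z"
      using growth[of 1] by blast
    obtain c where c: "\<And>Z. norm Z \<le> R \<Longrightarrow> ereal c \<le> f Z"
      using bounded_below_on_compact[OF assms(2,1) compact_cball[of 0 R]] by (metis mem_cball_0)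
    have lower: "ereal (min c 0) \<le> f Z" for Z
    proof (cases "norm Z \<le> R")
      case True
      then show ?thesis
        using c[of Z] by (metis ereal_less_eq(3) min.cobounded1 order_trans)
    next
      case False
      then have "ereal (min c 0) \<le> ereal (1 * norm Z ^ ?d)"
        by (simp add: min.coboundedI2)
      with R(2)[of Z] False show ?thesis by (meson not_le order_trans)
    qed
    have d: "1 \<le> ?d"
      by (simp add: Suc_le_eq)
    have bdd: "bounded {Z. f Z \<le> ereal t}" for t
    proof -
      have "norm Z \<le> max R t" if "f Z \<le> ereal t" for Z
      proof (cases "norm Z \<le> R")
        case False
        then have "ereal (1 * norm Z ^ ?d) \<le> ereal t"
          using R(2)[of Z] that by (meson not_le order_trans)
        moreover have "norm Z ^ 1 \<le> norm Z ^ ?d"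
          using False R(1) d by (intro power_increasing) auto
        ultimately show ?thesis by simp
      qed simp
      then show ?thesis
        by (auto simp: bounded_iff)
    qed
    have minors_growth: "\<exists>B. \<forall>Z t. f Z \<le> ereal t \<longrightarrow> norm (minors Z) \<le> e * t + B" if e: "0 < e" for e
    proof -
      obtain C where C: "0 \<le> C" "\<And>X :: real^'n::{finite,linorder}^'m::{finite,linorder}. 1 \<le> norm X \<Longrightarrow> norm (minors X) \<le> C * norm X ^ ?d"
        using norm_minors_le[where ?'m = 'm and ?'n = 'n] by metis
      \<comment> \<open>With the factor \<open>C / e\<close>, outside the ball
        \<open>norm (minors Z) <= C * norm Z ^ ?d <= e * t\<close> whenever
        \<open>f Z <= t\<close>.\<close>
      obtain r where r: "1 \<le> r" "\<And>Z. r < norm Z \<Longrightarrow> ereal (C / e * norm Z ^ ?d) \<le> f Z"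
        using growth[of "C / e"] by blast
      have "bounded ((minors :: real^'n::{finite,linorder}^'m::{finite,linorder} \<Rightarrow> _) ` cball 0 r)"
        by (intro compact_imp_bounded compact_continuous_image continuous_on_minors compact_cball)
      then obtain b where "\<forall>Z\<in>cball 0 r. norm (minors Z :: real^('m::{finite,linorder}, 'n::{finite,linorder}) minor_index) \<le> b"
        unfolding bounded_iff by blast
      then have b: "norm (minors Z) \<le> b" if "norm Z \<le> r" for Z :: "real^'n::{finite,linorder}^'m::{finite,linorder}"
        using that by simp
      \<comment> \<open>Inside the ball the minors are at most \<open>b\<close>, while
        \<open>e * t\<close> may be as low as \<open>- e * |c|\<close>; the additive constant
        compensates for both.\<close>
      have "norm (minors Z) \<le> e * t + (\<bar>b\<bar> + e * \<bar>c\<bar>)" if t: "f Z \<le> ereal t" for Z t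
      proof (cases "norm Z \<le> r")
        case True
        have "min c 0 \<le> t"
          using lower[of Z] t by (metis ereal_less_eq(3) order_trans)
        then have "e * - \<bar>c\<bar> \<le> e * t"
          using e by (intro mult_left_mono) auto
        then show ?thesis
          using b[OF True] by simp
      next
        case False
        then have "ereal (C / e * norm Z ^ ?d) \<le> ereal t"
          using r(2)[of Z] t by (meson not_le order_trans)
        then have "C * norm Z ^ ?d \<le> e * t"
          using e by (simp add: field_simps)
        moreover have "norm (minors Z) \<le> C * norm Z ^ ?d"
          using False r(1) by (intro C(2)) simp
        moreover have "0 \<le> \<bar>b\<bar> + e * \<bar>c\<bar>"
          using e by simp
        ultimately show ?thesis by linarith
      qed
      then show ?thesis by blast
    qed
    show "h X \<le> Sup ?A"
    \<comment> \<open>Passing to \<open>a < h X\<close> gives the strict inequality that separation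
      requires and also covers \<open>h X\<close> infinite. Only real \<open>a\<close> matters:
      minus infinity is trivial and plus infinity is impossible.\<close>
    proof (rule dense_le)
      fix a assume a: "a < h X"
      show "a \<le> Sup ?A"
      proof (cases a)
        case (real \<alpha>)
        have "\<exists>u v. (\<forall>Z. ereal (v + u \<bullet> minors Z) \<le> f Z) \<and> \<alpha> < v + u \<bullet> minors X"
          using exists_affine_minorant[OF continuous_on_minors assms(2) lower bdd minors_growth g(1),
              of \<alpha> "minors X"] h(2) g(2) a real
          by (metis comp_apply)
        then obtain u v where "?admissible u v" "\<alpha> < v + u \<bullet> minors X"
          unfolding admissible by blast
        then show ?thesis
          unfolding real by (intro Sup_upper2[of "ereal (v + u \<bullet> minors X)"]) auto
      qed (use a in auto)
    qed
  qed
qed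

end
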